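(* For every complex number $\beta$, $$\prod_{m\ge1}(1-x^m)^{\beta}=\sum_{\lambda\in\mathcal P}x^{|\lambda|+b(\lambda)}\prod_{v\in\lambda}\frac{c(v)-\beta}{h_v\,(1-x^{h_v})}.$$
   Context: $\mathcal P$ is the set of all partitions $\lambda=(\lambda_1\ge\cdots\ge\lambda_\ell>0)$, $|\lambda|=\sum_i\lambda_i$. The boxes of $\lambda$ are the pairs $(i,j)$ with $1\le i\le\ell$, $1\le j\le\lambda_i$. For a box $v=(i,j)$, the hook length is $h_v=\lambda_i-j+\lambda'_j-i+1$ with $\lambda'_j=\#\{k:\lambda_k\ge j\}$, and the content is $c(v)=j-i$. Also $b(\lambda)=\sum_i(i-1)\lambda_i$. For complex $s$, $(1-x^m)^s$ is the formal binomial series; each factor $1/(1-x^{h})$ is expanded as a power series in $x$. *)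

theory Defs
  imports "HOL-Analysis.Analysis"
begin

text \<open>
  A partition is the list of its parts, weakly decreasing and all positive. Rows and columns
  are numbered from 1 as in the mathematical convention, whereas list indexing starts at 0.
\<close>

definition partitions :: "nat list set" where
  "partitions = {l. sorted_wrt (\<ge>) l \<and> (\<forall>k\<in>set l. k > 0)}"

definition part :: "nat list \<Rightarrow> nat \<Rightarrow> nat" where
  "part l i = l ! (i - 1)"

definition conj_part :: "nat list \<Rightarrow> nat \<Rightarrow> nat" where
  "conj_part l j = card {k \<in> {1..length l}. part l k \<ge> j}"

definition boxes :: "nat list \<Rightarrow> (nat \<times> nat) set" where
  "boxes l = {(i, j). 1 \<le> i \<and> i \<le> length l \<and> 1 \<le> j \<and> j \<le> part l i}"

text \<open>
  For a box of a partition both differences in the hook length are nonnegative, so the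
  truncated subtraction on \<^typ>\<open>nat\<close> agrees with the integer one.
\<close>

definition hook_length :: "nat list \<Rightarrow> nat \<times> nat \<Rightarrow> nat" where
  "hook_length l = (\<lambda>(i, j). (part l i - j) + (conj_part l j - i) + 1)"

definition content :: "nat \<times> nat \<Rightarrow> int" where
  "content = (\<lambda>(i, j). int j - int i)"

definition b_stat :: "nat list \<Rightarrow> nat" where
  "b_stat l = (\<Sum>i = 1..length l. (i - 1) * part l i)"

text \<open>
  The formal binomial series $(1 - x^m)^s = \sum_k \binom{s}{k} (-x^m)^k$, for $m \ge 1$:
  \<^term>\<open>fps_binomial s\<close> is $(1 + x)^s$, into which $-x^m$ is substituted.
\<close>

definition binomial_series :: "nat \<Rightarrow> complex \<Rightarrow> complex fps" where
  "binomial_series m s = fps_compose (fps_binomial s) (- (fps_X ^ m))"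

text \<open>
  On power series, \<^const>\<open>inverse\<close> of a series with nonzero constant term is its
  multiplicative inverse, here the expansion $1 + x^h + x^{2h} + \cdots$ of $1/(1-x^h)$.
\<close>

definition hook_term :: "complex \<Rightarrow> nat list \<Rightarrow> complex fps" where
  "hook_term \<beta> l =
     fps_X ^ (sum_list l + b_stat l) *
     (\<Prod>v\<in>boxes l.
        fps_const ((of_int (content v) - \<beta>) / of_nat (hook_length l v)) *
        inverse (1 - fps_X ^ hook_length l v))"

end

theory Submission
  imports Defs "Jordan_Normal_Form.Determinant"
begin

text \<open>
  The coefficient of \<open>x\<^sup>N\<close> is a polynomial in \<open>\<beta>\<close> on both sides, so it suffices to treat
  \<open>\<beta> = -n\<close> for natural numbers \<open>n\<close>. Then only partitions with at most \<open>n\<close> rows contribute, and in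
  terms of the beta numbers \<open>b\<^sub>i = \<lambda>\<^sub>i + n - 1 - i\<close> (rows numbered from 0) the content and hook
  products become products of two Vandermonde determinants. By the Cauchy--Binet formula their sum is the
  single determinant with entries \<open>\<Sum>\<^sub>l (l choose i) x\<^sup>l\<^sup>(\<^sup>j\<^sup>+\<^sup>1\<^sup>) / (x;x)\<^sub>l\<close>. The functional equation
  \<open>E(x z) = (1 - z) E(z)\<close> of Euler's series \<open>E(z) = \<Sum>\<^sub>l z\<^sup>l / (x;x)\<^sub>l\<close> factors this matrix into two
  triangular ones, and the determinant is \<open>E(x)\<^sup>n\<close> up to a sign and a power of \<open>x\<close>. All sums
  are truncated at \<open>l < M\<close>, and the identities hold modulo \<open>x\<^sup>M\<close>.
\<close>

subsection \<open>The Cauchy--Binet formula and Vandermonde determinants\<close>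

text \<open>These encode the \<open>n\<close>-element subsets of \<open>{..<M}\<close>. Listing each
  in decreasing order lets entry \<open>k\<close> serve as the beta number of row
  \<open>k\<close>.\<close>

definition decreasing_lists :: "nat \<Rightarrow> nat \<Rightarrow> nat list set" where
  "decreasing_lists n M = {L. length L = n \<and> sorted_wrt (>) L \<and> set L \<subseteq> {..<M}}"

lemma finite_decreasing_lists: "finite (decreasing_lists n M)"
  by (rule finite_subset[OF _ finite_lists_length_eq[of "{..<M}" n]])
     (auto simp: decreasing_lists_def)

lemma decreasing_list_distinct: "sorted_wrt (>) (L :: nat list) \<Longrightarrow> distinct L"
  by (induction L) auto

lemma decreasing_lists_eqI:
  assumes "sorted_wrt (>) (L :: nat list)" "sorted_wrt (>) L'" "set L = set L'"
  shows "L = L'"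
proof -
  have "rev L = rev L'"
    using assms by (intro strict_sorted_equal) (simp_all add: sorted_wrt_rev)
  then show ?thesis by simp
qed

text \<open>An injective map is determined by its image, listed in decreasing order, and the
  permutation that restores the order of its values. This regroups the surviving terms of the
  Cauchy--Binet expansion.\<close>

lemma bij_betw_inj_decreasing:
  "bij_betw (\<lambda>(L, p). \<lambda>i\<in>{0..<n}. L ! p i)
     (decreasing_lists n M \<times> {p. p permutes {0..<n}})
     {f \<in> {0..<n} \<rightarrow>\<^sub>E {..<M}. inj_on f {0..<n}}"
proof (rule bij_betw_imageI)
  show "inj_on (\<lambda>(L, p). \<lambda>i\<in>{0..<n}. L ! p i)
     (decreasing_lists n M \<times> {p. p permutes {0..<n}})"
  proof (rule inj_onI, clarify)
    fix L p L' p'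
    assume L: "L \<in> decreasing_lists n M" and L': "L' \<in> decreasing_lists n M"
      and p: "p permutes {0..<n}" and p': "p' permutes {0..<n}"
      and eq: "(\<lambda>i\<in>{0..<n}. L ! p i) = (\<lambda>i\<in>{0..<n}. L' ! p' i)"
    have nth: "L ! p i = L' ! p' i" if "i < n" for i
      using fun_cong[OF eq, of i] that by simp
    \<comment> \<open>The image of the map is the entry set of the list, so equal maps force equal
      lists; distinctness of the entries then forces equal permutations.\<close>
    have img: "set K = (\<lambda>i. K ! q i) ` {0..<n}"
      if "K \<in> decreasing_lists n M" "q permutes {0..<n}" for K q
    proof -
      have "(\<lambda>i. K ! q i) ` {0..<n} = (!) K ` (q ` {0..<n})" by (simp add: image_image)
      also have "\<dots> = set K"
        using that by (simp add: permutes_image decreasing_lists_def) (auto simp: set_conv_nth)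
      finally show ?thesis by simp
    qed
    have "set L = set L'"
      using nth by (simp add: img[OF L p] img[OF L' p'])
    with L L' have LL: "L = L'"
      by (auto simp: decreasing_lists_def intro: decreasing_lists_eqI)
    have "p i = p' i" for i
    proof (cases "i < n")
      case True
      then have "p i < n" "p' i < n"
        using p p' by (metis atLeastLessThan_iff permutes_in_image zero_le)+
      moreover have "L ! p i = L ! p' i" using nth[OF True] LL by simp
      ultimately show ?thesis
        using L decreasing_list_distinct[of L] nth_eq_iff_index_eq[of L "p i" "p' i"]
        by (auto simp: decreasing_lists_def)
    next
      case False
      then show ?thesis using p p' by (metis atLeastLessThan_iff permutes_def)
    qed
    with LL show "L = L' \<and> p = p'" by auto
  qed
next
  show "(\<lambda>(L, p). \<lambda>i\<in>{0..<n}. L ! p i) ` (decreasing_lists n M \<times> {p. p permutes {0..<n}})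
        = {f \<in> {0..<n} \<rightarrow>\<^sub>E {..<M}. inj_on f {0..<n}}" (is "?g ` ?D = ?R")
  proof
    show "?g ` ?D \<subseteq> ?R"
    proof clarify
      fix L p assume L: "L \<in> decreasing_lists n M" and p: "p permutes {0..<n}"
      have lt: "p i < n" if "i < n" for i
        using p that by (metis atLeastLessThan_iff permutes_in_image zero_le)
      have "L ! p i < M" if "i < n" for i
        using L lt[OF that] nth_mem[of "p i" L] unfolding decreasing_lists_def by blast
      moreover have "inj_on (\<lambda>i. L ! p i) {0..<n}"
      proof (rule inj_onI)
        fix i j assume "i \<in> {0..<n}" "j \<in> {0..<n}" "L ! p i = L ! p j"
        then have "p i = p j"
          using L decreasing_list_distinct[of L] lt nth_eq_iff_index_eq[of L "p i" "p j"]
          by (auto simp: decreasing_lists_def)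
        then show "i = j" using p by (meson injD permutes_inj)
      qed
      ultimately show "(\<lambda>i\<in>{0..<n}. L ! p i) \<in> {0..<n} \<rightarrow>\<^sub>E {..<M} \<and>
          inj_on (\<lambda>i\<in>{0..<n}. L ! p i) {0..<n}"
        by (auto simp: inj_on_def)
    qed
    show "?R \<subseteq> ?g ` ?D"
    proof clarify
      fix f assume f: "f \<in> {0..<n} \<rightarrow>\<^sub>E {..<M}" and inj: "inj_on f {0..<n}"
      define L where "L = rev (sorted_list_of_set (f ` {0..<n}))"
      have len: "length L = n" using inj by (simp add: L_def card_image)
      have set: "set L = f ` {0..<n}" by (simp add: L_def)
      have sorted: "sorted_wrt (>) L" by (simp add: L_def sorted_wrt_rev)
      have L: "L \<in> decreasing_lists n M"
        using len set sorted f by (auto simp: decreasing_lists_def PiE_def Pi_def)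
      have bij1: "bij_betw ((!) L) {0..<n} (f ` {0..<n})"
        using bij_betw_nth[of L "{0..<n}" "f ` {0..<n}"] decreasing_list_distinct[OF sorted] len set
        by (simp add: atLeast0LessThan)
      have bij: "bij_betw (inv_into {0..<n} ((!) L) \<circ> f) {0..<n} {0..<n}"
        by (rule bij_betw_trans[OF inj_on_imp_bij_betw[OF inj] bij_betw_inv_into[OF bij1]])
      \<comment> \<open>Extended by the identity, because \<open>permutes\<close> requires fixed
        points outside \<open>{0..<n}\<close>.\<close>
      define p where "p = (\<lambda>i. if i \<in> {0..<n} then (inv_into {0..<n} ((!) L) \<circ> f) i else i)"
      have "bij_betw p {0..<n} {0..<n}"
        using bij by (subst bij_betw_cong[of _ _ "inv_into {0..<n} ((!) L) \<circ> f"]) (auto simp: p_def)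
      then have p: "p permutes {0..<n}" by (rule bij_imp_permutes) (auto simp: p_def)
      have "f = ?g (L, p)"
      proof
        fix i
        show "f i = ?g (L, p) i"
        proof (cases "i < n")
          case True
          then have "f i \<in> (!) L ` {0..<n}" using bij1 by (simp add: bij_betw_def)
          with True show ?thesis by (simp add: p_def f_inv_into_f)
        next
          case False
          then show ?thesis using f by (auto simp: PiE_def extensional_def)
        qed
      qed
      with L p show "f \<in> ?g ` ?D" by blast
    qed
  qed
qed

text \<open>Expanding the product of row sums yields one term for each choice \<open>f\<close> of an
  inner index per row. A repeated index gives two equal rows of \<open>B\<close> and vanishes; the
  injective choices with a common image assemble to a product of two minors.\<close>

lemma cauchy_binet:
  fixes A B :: "nat \<Rightarrow> nat \<Rightarrow> 'a :: comm_ring_1"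
  shows "det (mat n n (\<lambda>(i, j). \<Sum>l<M. A i l * B l j)) =
    (\<Sum>L\<in>decreasing_lists n M.
       det (mat n n (\<lambda>(i, k). A i (L ! k))) * det (mat n n (\<lambda>(k, j). B (L ! k) j)))"
proof -
  let ?P = "{p. p permutes {0..<n}}" and ?F = "{0..<n} \<rightarrow>\<^sub>E {..<M}"
  define D where "D = (\<lambda>f. det (mat n n (\<lambda>(i, j). B (f i) j)))"
  have lt: "p i < n" if "p permutes {0..<n}" "i < n" for p i
    using that by (metis atLeastLessThan_iff permutes_in_image zero_le)
  have D_not_inj: "D f = 0" if "\<not> inj_on f {0..<n}" for f
  proof -
    from that obtain i j where "i < n" "j < n" "i \<noteq> j" "f i = f j"
      by (auto simp: inj_on_def)
    then show ?thesis unfolding D_def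
      by (intro det_identical_rows[of _ n i j]) auto
  qed
  have D_perm: "D (\<lambda>i. L ! p i) = signof p * D ((!) L)" if "p permutes {0..<n}" for p L
  proof -
    have "D (\<lambda>i. L ! p i) =
        det (mat n n (\<lambda>(i, j). mat n n (\<lambda>(i, j). B (L ! i) j) $$ (p i, j)))"
      unfolding D_def by (intro arg_cong[of _ _ det] eq_matI) (auto simp: lt[OF that])
    also have "\<dots> = signof p * D ((!) L)"
      unfolding D_def by (rule det_permute_rows[OF _ that]) simp
    finally show ?thesis .
  qed
  have "det (mat n n (\<lambda>(i, j). \<Sum>l<M. A i l * B l j)) =
      (\<Sum>p\<in>?P. signof p * (\<Prod>i=0..<n. \<Sum>l<M. A i l * B l (p i)))"
    by (subst det_def'[of _ n])
       (auto intro!: sum.cong arg_cong2[of _ _ _ _ "(*)"] prod.cong simp: lt)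
  also have "\<dots> = (\<Sum>p\<in>?P. signof p * (\<Sum>f\<in>?F. \<Prod>i=0..<n. A i (f i) * B (f i) (p i)))"
    by (subst prod_sum_PiE) auto
  also have "\<dots> = (\<Sum>f\<in>?F. \<Sum>p\<in>?P. signof p * (\<Prod>i=0..<n. A i (f i) * B (f i) (p i)))"
    by (subst sum.swap) (simp add: sum_distrib_left)
  also have "\<dots> = (\<Sum>f\<in>?F. (\<Prod>i=0..<n. A i (f i)) * D f)"
  proof (rule sum.cong[OF refl])
    fix f
    have "D f = (\<Sum>p\<in>?P. signof p * (\<Prod>i=0..<n. B (f i) (p i)))"
      unfolding D_def
      by (subst det_def'[of _ n])
         (auto intro!: sum.cong arg_cong2[of _ _ _ _ "(*)"] prod.cong simp: lt)
    then show "(\<Sum>p\<in>?P. signof p * (\<Prod>i=0..<n. A i (f i) * B (f i) (p i))) =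
        (\<Prod>i=0..<n. A i (f i)) * D f"
      by (simp add: prod.distrib sum_distrib_left mult_ac)
  qed
  also have "\<dots> = (\<Sum>f | f \<in> ?F \<and> inj_on f {0..<n}. (\<Prod>i=0..<n. A i (f i)) * D f)"
    by (rule sum.mono_neutral_right) (auto simp: finite_PiE D_not_inj)
  also have "\<dots> = (\<Sum>(L, p)\<in>decreasing_lists n M \<times> ?P.
      (\<Prod>i=0..<n. A i (L ! p i)) * D (\<lambda>i. L ! p i))"
  proof (subst sum.reindex_bij_betw[OF bij_betw_inj_decreasing, symmetric], rule sum.cong[OF refl], clarify)
    fix L p
    have "D (\<lambda>i\<in>{0..<n}. L ! p i) = D (\<lambda>i. L ! p i)"
      unfolding D_def by (intro arg_cong[of _ _ det] eq_matI) auto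
    then show "(\<Prod>i=0..<n. A i ((\<lambda>i\<in>{0..<n}. L ! p i) i)) * D (\<lambda>i\<in>{0..<n}. L ! p i)
        = (\<Prod>i=0..<n. A i (L ! p i)) * D (\<lambda>i. L ! p i)"
      by simp
  qed
  also have "\<dots> = (\<Sum>L\<in>decreasing_lists n M. \<Sum>p\<in>?P.
      (\<Prod>i=0..<n. A i (L ! p i)) * D (\<lambda>i. L ! p i))"
    by (simp add: sum.cartesian_product)
  also have "\<dots> = (\<Sum>L\<in>decreasing_lists n M.
       det (mat n n (\<lambda>(i, k). A i (L ! k))) * D ((!) L))"
  proof (rule sum.cong[OF refl])
    fix L
    have "det (mat n n (\<lambda>(i, k). A i (L ! k))) =
        (\<Sum>p\<in>?P. signof p * (\<Prod>i=0..<n. A i (L ! p i)))"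
      by (subst det_def'[of _ n])
         (auto intro!: sum.cong arg_cong2[of _ _ _ _ "(*)"] prod.cong simp: lt)
    then show "(\<Sum>p\<in>?P. (\<Prod>i=0..<n. A i (L ! p i)) * D (\<lambda>i. L ! p i)) =
        det (mat n n (\<lambda>(i, k). A i (L ! k))) * D ((!) L)"
      by (simp add: D_perm sum_distrib_left mult_ac)
  qed
  finally show ?thesis by (simp add: D_def)
qed

lemma det_lower_triangular_mat:
  assumes "\<And>i j. i < j \<Longrightarrow> j < n \<Longrightarrow> f i j = (0 :: 'a :: comm_ring_1)"
  shows "det (mat n n (\<lambda>(i, j). f i j)) = (\<Prod>i<n. f i i)"
  using assms
  by (subst det_lower_triangular[of n])
     (auto simp: prod_list_diag_prod atLeast0LessThan)

lemma det_upper_triangular_mat: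
  assumes "\<And>i j. j < i \<Longrightarrow> i < n \<Longrightarrow> f i j = (0 :: 'a :: comm_ring_1)"
  shows "det (mat n n (\<lambda>(i, j). f i j)) = (\<Prod>i<n. f i i)"
  using assms
  by (subst det_upper_triangular[of _ n])
     (auto simp: prod_list_diag_prod atLeast0LessThan upper_triangular_def)

lemma det_mat_mult:
  fixes f g :: "nat \<Rightarrow> nat \<Rightarrow> 'a :: comm_ring_1"
  shows "det (mat n n (\<lambda>(i, j). \<Sum>k<n. f i k * g k j)) =
    det (mat n n (\<lambda>(i, j). f i j)) * det (mat n n (\<lambda>(i, j). g i j))"
proof -
  have "mat n n (\<lambda>(i, j). \<Sum>k<n. f i k * g k j) =
      mat n n (\<lambda>(i, j). f i j) * mat n n (\<lambda>(i, j). g i j)"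
    by (rule eq_matI) (auto simp: scalar_prod_def atLeast0LessThan)
  then show ?thesis by (simp add: det_mult[of _ n])
qed

text \<open>The change of basis between Newton and ordinary monomials is unitriangular, so the
  nodes \<open>t\<close> do not matter; for \<open>t = a\<close> the matrix itself is triangular.\<close>

lemma det_newton_vandermonde:
  fixes a t :: "nat \<Rightarrow> 'a :: comm_ring_1"
  shows "det (mat n n (\<lambda>(i, j). \<Prod>k<j. a i - t k)) = (\<Prod>j<n. \<Prod>k<j. a j - a k)"
proof -
  have *: "det (mat n n (\<lambda>(i, j). \<Prod>k<j. a i - t k)) = det (mat n n (\<lambda>(i, j). a i ^ j))"
    for t :: "nat \<Rightarrow> 'a"
  proof -
    define N where "N = (\<lambda>j. \<Prod>k<j. [:- t k, 1:])"
    have N: "degree (N j) \<le> j \<and> coeff (N j) j = 1" for j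
    proof (induction j)
      case (Suc j)
      have eq: "N (Suc j) = Polynomial.smult (- t j) (N j) + pCons 0 (N j)"
        by (simp add: N_def mult.commute[of _ "[:- t j, 1:]"])
      have "degree (N (Suc j)) \<le> Suc j"
        unfolding eq using Suc degree_pCons_le[of 0 "N j"]
        by (intro degree_add_le) (auto intro: order.trans[OF degree_smult_le])
      moreover have "coeff (N (Suc j)) (Suc j) = 1"
        unfolding eq using Suc by (simp add: coeff_eq_0)
      ultimately show ?case by simp
    qed (simp add: N_def)
    have "(\<Prod>k<j. a i - t k) = (\<Sum>k<n. a i ^ k * coeff (N j) k)" if "j < n" for i j
    proof -
      have "(\<Prod>k<j. a i - t k) = poly (N j) (a i)"
        by (simp add: N_def poly_prod algebra_simps)
      also have "\<dots> = (\<Sum>k\<le>degree (N j). coeff (N j) k * a i ^ k)"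
        by (rule poly_altdef)
      also have "\<dots> = (\<Sum>k<n. coeff (N j) k * a i ^ k)"
        using N[of j] that by (intro sum.mono_neutral_left) (auto simp: coeff_eq_0)
      finally show ?thesis by (simp add: mult.commute)
    qed
    then have "mat n n (\<lambda>(i, j). \<Prod>k<j. a i - t k) =
        mat n n (\<lambda>(i, j). \<Sum>k<n. a i ^ k * coeff (N j) k)"
      by (intro eq_matI) auto
    moreover have "det (mat n n (\<lambda>(k, j). coeff (N j) k)) = 1"
      using N by (subst det_upper_triangular_mat) (auto intro: coeff_eq_0 le_less_trans)
    ultimately show ?thesis by (simp add: det_mat_mult)
  qed
  have "det (mat n n (\<lambda>(i, j). \<Prod>k<j. a i - a k)) = (\<Prod>j<n. \<Prod>k<j. a j - a k)"
    by (rule det_lower_triangular_mat) (auto intro!: prod_zero)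
  then show ?thesis using *[of t] *[of a] by simp
qed

text \<open>Scaling rows is left multiplication by a diagonal matrix.\<close>

lemma det_scale_rows:
  fixes f :: "nat \<Rightarrow> nat \<Rightarrow> 'a :: comm_ring_1"
  shows "det (mat n n (\<lambda>(i, j). c i * f i j)) = (\<Prod>i<n. c i) * det (mat n n (\<lambda>(i, j). f i j))"
proof -
  have "(\<Sum>k<n. (if i = k then c i else 0) * f k j) = c i * f i j" if "i < n" for i j
    using that by (simp add: if_distrib[of "\<lambda>x. x * _"] cong: if_cong)
  then have "mat n n (\<lambda>(i, j). c i * f i j) =
      mat n n (\<lambda>(i, j). \<Sum>k<n. (if i = k then c i else 0) * f k j)"
    by (intro eq_matI) auto
  then show ?thesis
    by (simp only: det_mat_mult) (subst det_lower_triangular_mat, auto)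
qed

subsection \<open>Beta numbers and hook lengths\<close>

text \<open>Rows are numbered from 0 here. The value 0 past the last row pads a partition with at
  most \<open>n\<close> parts to exactly \<open>n\<close> rows.\<close>

definition row_length :: "nat list \<Rightarrow> nat \<Rightarrow> nat" where
  "row_length l i = (if i < length l then l ! i else 0)"

definition beta_number :: "nat \<Rightarrow> nat list \<Rightarrow> nat \<Rightarrow> nat" where
  "beta_number n l i = row_length l i + (n - 1 - i)"

lemma row_length_antimono:
  assumes "l \<in> partitions" "i \<le> k"
  shows "row_length l k \<le> row_length l i"
proof (cases "i = k")
  case False
  with assms show ?thesis
    using sorted_wrt_nth_less[of "(\<ge>)" l i k]
    by (auto simp: row_length_def partitions_def)
qed simp

text \<open>Row lengths decrease, so the rows of length at least \<open>j\<close> form an initial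
  segment, and \<open>conj_part l j\<close> is its size. All comparisons of rows with columns go
  through this equivalence.\<close>

lemma le_row_length_iff:
  assumes "l \<in> partitions" "1 \<le> j"
  shows "j \<le> row_length l k \<longleftrightarrow> k < conj_part l j"
proof -
  \<comment> \<open>The first row shorter than \<open>j\<close>; it exists because the padded row
    \<open>length l\<close> is empty and \<open>j\<close> is positive.\<close>
  define c where "c = (LEAST k. row_length l k < j)"
  have ex: "row_length l (length l) < j" using assms by (simp add: row_length_def)
  have c1: "row_length l c < j" unfolding c_def by (rule LeastI[of _ "length l"]) (rule ex)
  have c: "j \<le> row_length l k \<longleftrightarrow> k < c" for k
  proof
    assume "j \<le> row_length l k"
    then show "k < c"
      using c1 row_length_antimono[OF assms(1), of c k] by (meson leD le_trans not_le)
  next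
    assume "k < c"
    then show "j \<le> row_length l k" unfolding c_def by (meson not_le not_less_Least)
  qed
  \<comment> \<open>The shift by \<open>Suc\<close> passes from rows numbered from 0 to the rows
    numbered from 1 in \<open>conj_part\<close>.\<close>
  have "{k \<in> {1..length l}. j \<le> part l k} = Suc ` {..<c}"
  proof (intro Set.set_eqI iffI)
    fix k assume k: "k \<in> {k \<in> {1..length l}. j \<le> part l k}"
    then have "j \<le> row_length l (k - 1)" by (auto simp: part_def row_length_def)
    then have "k - 1 < c" using c by blast
    moreover have "k = Suc (k - 1)" using k by simp
    ultimately show "k \<in> Suc ` {..<c}" by blast
  next
    fix k assume "k \<in> Suc ` {..<c}"
    then obtain k' where k': "k = Suc k'" "j \<le> row_length l k'" using c by blast
    with assms(2) show "k \<in> {k \<in> {1..length l}. j \<le> part l k}"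
      by (auto simp: part_def row_length_def split: if_splits)
  qed
  then have "conj_part l j = c"
    by (simp add: conj_part_def card_image)
  with c show ?thesis by simp
qed

lemma conj_part_antimono:
  assumes "l \<in> partitions" "1 \<le> j" "j \<le> j'"
  shows "conj_part l j' \<le> conj_part l j"
  using assms le_row_length_iff[of l j "conj_part l j"] le_row_length_iff[of l j' "conj_part l j"]
  by auto

lemma conj_part_le_length:
  assumes "l \<in> partitions" "1 \<le> j"
  shows "conj_part l j \<le> length l"
  using assms le_row_length_iff[of l j "length l"] by (auto simp: row_length_def)

lemma hook_length_row:
  assumes "j \<in> {1..row_length l i}"
  shows "hook_length l (Suc i, j) = (row_length l i - j) + (conj_part l j - Suc i) + 1"
  using assms by (auto simp: hook_length_def part_def row_length_def split: if_splits)

text \<open>The hook lengths of a row together with the differences of its beta number to the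
  later ones fill out an initial segment without repetition.\<close>

lemma prod_hook_row:
  fixes \<phi> :: "nat \<Rightarrow> 'a :: comm_monoid_mult"
  assumes l: "l \<in> partitions" and n: "length l \<le> n" and i: "i < n"
  shows "(\<Prod>j=1..row_length l i. \<phi> (hook_length l (Suc i, j))) *
      (\<Prod>k\<in>{i<..<n}. \<phi> (beta_number n l i - beta_number n l k)) =
    (\<Prod>m=1..beta_number n l i. \<phi> m)"
proof -
  define h where "h = (\<lambda>j. hook_length l (Suc i, j))"
  define d where "d = (\<lambda>k. beta_number n l i - beta_number n l k)"
  let ?J = "{1..row_length l i}" and ?K = "{i<..<n}"
  \<comment> \<open>Moving the subtracted terms to the left keeps the later arithmetic free of
    truncated subtraction.\<close>
  have h: "h j + j + i = row_length l i + conj_part l j \<and> i < conj_part l j \<and> conj_part l j \<le> n"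
    if "j \<in> ?J" for j
    using that le_row_length_iff[OF l, of j i] hook_length_row[OF that] n
      conj_part_le_length[OF l, of j] by (auto simp: h_def)
  have d: "d k + row_length l k + i = row_length l i + k" if "k \<in> ?K" for k
    using that row_length_antimono[OF l, of i k] by (auto simp: d_def beta_number_def)
  have inj_h: "inj_on h ?J"
  proof (rule linorder_inj_onI')
    fix j j' assume "j \<in> ?J" "j' \<in> ?J" "j < j'"
    then show "h j \<noteq> h j'"
      using h[of j] h[of j'] conj_part_antimono[OF l, of j j'] by auto
  qed
  have inj_d: "inj_on d ?K"
  proof (rule linorder_inj_onI')
    fix k k' assume "k \<in> ?K" "k' \<in> ?K" "k < k'"
    then show "d k \<noteq> d k'"
      using d[of k] d[of k'] row_length_antimono[OF l, of k k'] by auto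
  qed
  \<comment> \<open>Equality \<open>h j = d k\<close> would mean
    \<open>conj_part l j + row_length l k = j + k\<close>. If \<open>j \<le> row_length l k\<close>
    then \<open>k < conj_part l j\<close> and the left side is larger; otherwise it is
    smaller.\<close>
  have disj: "h ` ?J \<inter> d ` ?K = {}"
  proof -
    have "h j \<noteq> d k" if "j \<in> ?J" "k \<in> ?K" for j k
      using h[OF that(1)] d[OF that(2)] le_row_length_iff[OF l, of j k] that by fastforce
    then show ?thesis by blast
  qed
  have sub: "h ` ?J \<union> d ` ?K \<subseteq> {1..beta_number n l i}"
  proof -
    have "h j \<in> {1..beta_number n l i}" if "j \<in> ?J" for j
      using h[OF that] that i by (auto simp: beta_number_def)
    moreover have "d k \<in> {1..beta_number n l i}" if "k \<in> ?K" for k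
      using d[OF that] that row_length_antimono[OF l, of i k] by (auto simp: beta_number_def)
    ultimately show ?thesis by blast
  qed
  \<comment> \<open>There are \<open>row_length l i\<close> hooks and \<open>n - 1 - i\<close>
    differences, together \<open>beta_number n l i\<close> values, so the inclusion is an
    equality.\<close>
  have "card (h ` ?J \<union> d ` ?K) = card {1..beta_number n l i}"
    using disj inj_h inj_d i
    by (simp add: card_Un_disjoint card_image beta_number_def)
  with sub have eq: "{1..beta_number n l i} = h ` ?J \<union> d ` ?K"
    by (metis card_subset_eq finite_atLeastAtMost)
  have "prod \<phi> {1..beta_number n l i} = prod \<phi> (h ` ?J) * prod \<phi> (d ` ?K)"
    unfolding eq by (rule prod.union_disjoint) (use disj in auto)
  also have "\<dots> = (\<Prod>j\<in>?J. \<phi> (h j)) * (\<Prod>k\<in>?K. \<phi> (d k))"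
    by (simp only: prod.reindex[OF inj_h] prod.reindex[OF inj_d] o_def)
  finally show ?thesis by (simp only: h_def d_def)
qed

lemma prod_boxes:
  assumes "length l \<le> n"
  shows "(\<Prod>v\<in>boxes l. g v) = (\<Prod>i<n. \<Prod>j=1..row_length l i. g (Suc i, j))"
proof -
  have "boxes l = (\<lambda>(i, j). (Suc i, j)) ` (SIGMA i:{..<n}. {1..row_length l i})"
  proof (intro Set.set_eqI iffI)
    fix v assume "v \<in> boxes l"
    then show "v \<in> (\<lambda>(i, j). (Suc i, j)) ` (SIGMA i:{..<n}. {1..row_length l i})"
      using assms
      by (auto simp: boxes_def part_def row_length_def intro!: image_eqI[of _ _ "(fst v - 1, snd v)"])
  qed (auto simp: boxes_def part_def row_length_def split: if_splits)
  moreover have "inj_on (\<lambda>(i, j). (Suc i, j)) (SIGMA i:{..<n}. {1..row_length l i})"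
    by (auto simp: inj_on_def)
  ultimately show ?thesis
    by (simp add: prod.reindex prod.Sigma case_prod_unfold)
qed

text \<open>The row identities are multiplied over all rows. The function \<open>\<phi>\<close>
  stays arbitrary because two instances are needed: \<open>of_nat\<close> for the hook lengths, and
  \<open>1 - fps_X ^ m\<close> for the factors in \<open>x\<close>.\<close>

lemma prod_hook_length:
  fixes \<phi> :: "nat \<Rightarrow> 'a :: comm_monoid_mult"
  assumes l: "l \<in> partitions" and n: "length l \<le> n"
  shows "(\<Prod>v\<in>boxes l. \<phi> (hook_length l v)) *
      (\<Prod>j<n. \<Prod>k<j. \<phi> (beta_number n l k - beta_number n l j)) =
    (\<Prod>i<n. \<Prod>m=1..beta_number n l i. \<phi> m)"
proof -
  have "(\<Prod>j<n. \<Prod>k<j. \<phi> (beta_number n l k - beta_number n l j)) =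
      (\<Prod>j<n. \<Prod>k | k \<in> {..<n} \<and> k < j. \<phi> (beta_number n l k - beta_number n l j))"
    by (intro prod.cong) auto
  \<comment> \<open>The pairs are regrouped by their smaller index, which is the row whose hooks
    they complement.\<close>
  also have "\<dots> = (\<Prod>k<n. \<Prod>j | j \<in> {..<n} \<and> k < j. \<phi> (beta_number n l k - beta_number n l j))"
    by (rule prod.swap_restrict) auto
  also have "\<dots> = (\<Prod>k<n. \<Prod>j\<in>{k<..<n}. \<phi> (beta_number n l k - beta_number n l j))"
    by (intro prod.cong) auto
  finally show ?thesis
    by (simp only: prod_boxes[OF n] prod.distrib[symmetric])
       (intro prod.cong refl prod_hook_row[OF l n], simp)
qed


text \<open>Along row \<open>i\<close> the numbers content plus \<open>n\<close> run through
  consecutive integers from \<open>n - i\<close> to the beta number, so the row contributes a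
  quotient of two factorials.\<close>

lemma prod_content:
  assumes n: "length l \<le> n"
  shows "(\<Prod>v\<in>boxes l. of_int (content v) + of_nat n) * (\<Prod>i<n. fact i) =
    (\<Prod>i<n. fact (beta_number n l i) :: 'a :: {comm_ring_1, semiring_char_0})"
proof -
  have row: "(\<Prod>j=1..r. of_int (content (Suc i, j)) + of_nat n) * fact m =
      (fact (r + m) :: 'a)" if "n = Suc (i + m)" for i m r
  proof (induction r)
    case (Suc r)
    have "of_int (content (Suc i, Suc r)) + of_nat n = (of_nat (Suc r + m) :: 'a)"
      using that by (simp add: content_def)
    then show ?case by (simp add: Suc.IH[symmetric] mult_ac)
  qed simp
  have "(\<Prod>i<n. fact i :: 'a) = (\<Prod>i<n. fact (n - 1 - i))"
    by (rule sym) (use prod.nat_diff_reindex[of fact n] in simp)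
  then show ?thesis
    by (simp only: prod_boxes[OF n] beta_number_def prod.distrib[symmetric])
       (intro prod.cong refl row, simp)
qed

text \<open>With rows numbered from 0, \<open>sum_list l + b_stat l\<close> weights row
  \<open>i\<close> by \<open>Suc i\<close>; passing to beta numbers adds only the staircase
  constant. The right side is the exponent of \<open>x\<close> produced by the Vandermonde
  determinant in powers of \<open>x\<close>.\<close>

lemma size_b_stat_beta_number:
  assumes n: "length l \<le> n"
  shows "sum_list l + b_stat l + (\<Sum>i<n. Suc i * (n - 1 - i)) =
    (\<Sum>i<n. Suc i * beta_number n l i)"
proof -
  have ext: "(\<Sum>i<length l. f i * l ! i) = (\<Sum>i<n. f i * row_length l i)" for f
    using n by (intro sum.mono_neutral_cong_left) (auto simp: row_length_def)
  have "sum_list l = (\<Sum>i<n. row_length l i)"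
    using ext[of "\<lambda>_. 1"] by (simp add: sum_list_sum_nth atLeast0LessThan)
  moreover have "b_stat l = (\<Sum>i<n. i * row_length l i)"
    unfolding ext[symmetric] b_stat_def part_def
    by (rule sum.reindex_bij_witness[of _ Suc "\<lambda>i. i - 1"]) auto
  ultimately show ?thesis
    by (simp only: beta_number_def add_mult_distrib2 mult_Suc sum.distrib ac_simps)
qed

lemma decreasing_list_gap:
  assumes "sorted_wrt (>) L" "i \<le> k" "k < length L"
  shows "L ! k + (k - i) \<le> (L ! i :: nat)"
  using assms(2,3)
proof (induction k rule: dec_induct)
  case (step m)
  have "L ! Suc m < L ! m" using assms(1) step by (auto intro: sorted_wrt_nth_less)
  with step show ?case by (simp add: Suc_diff_le)
qed simp

lemma partition_eqI:
  assumes "l \<in> partitions" "l' \<in> partitions" "\<And>i. row_length l i = row_length l' i"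
  shows "l = l'"
proof -
  have pos: "0 < row_length m i \<longleftrightarrow> i < length m" if "m \<in> partitions" for m i
    using that by (auto simp: partitions_def row_length_def)
  have iff: "i < length l \<longleftrightarrow> i < length l'" for i
    using pos[OF assms(1), of i] pos[OF assms(2), of i] assms(3)[of i] by simp
  have "length l = length l'"
    using iff[of "length l"] iff[of "length l'"] by auto
  then show ?thesis
    using assms(3) by (intro nth_equalityI) (auto simp: row_length_def, metis)
qed

text \<open>The inverse subtracts the staircase and drops trailing zeros. The bound on the parts
  says that the largest beta number is below \<open>M\<close>.\<close>

lemma bij_betw_beta_numbers:
  assumes "n \<le> M"
  shows "bij_betw (\<lambda>l. map (beta_number n l) [0..<n])
    {l \<in> partitions. length l \<le> n \<and> (\<forall>k\<in>set l. k + n \<le> M)} (decreasing_lists n M)"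
proof (rule bij_betw_imageI)
  let ?P = "{l \<in> partitions. length l \<le> n \<and> (\<forall>k\<in>set l. k + n \<le> M)}"
  show "inj_on (\<lambda>l. map (beta_number n l) [0..<n]) ?P"
  proof (rule inj_onI)
    fix l l' assume l: "l \<in> ?P" "l' \<in> ?P"
      and eq: "map (beta_number n l) [0..<n] = map (beta_number n l') [0..<n]"
    have "row_length l i = row_length l' i" for i
    proof (cases "i < n")
      case True
      then have "beta_number n l i = beta_number n l' i" using eq by auto
      then show ?thesis by (simp add: beta_number_def)
    next
      case False
      then show ?thesis using l by (simp add: row_length_def)
    qed
    then show "l = l'" using l by (auto intro: partition_eqI)
  qed
  show "(\<lambda>l. map (beta_number n l) [0..<n]) ` ?P = decreasing_lists n M"
  proof
    show "(\<lambda>l. map (beta_number n l) [0..<n]) ` ?P \<subseteq> decreasing_lists n M"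
    proof clarify
      fix l assume l: "l \<in> partitions" and n: "length l \<le> n" and M: "\<forall>k\<in>set l. k + n \<le> M"
      have "beta_number n l i < M" if "i < n" for i
        using M that assms nth_mem[of i l] by (fastforce simp: beta_number_def row_length_def)
      moreover have "beta_number n l k < beta_number n l i" if "i < k" "k < n" for i k
        using row_length_antimono[OF l, of i k] that by (simp add: beta_number_def)
      ultimately show "map (beta_number n l) [0..<n] \<in> decreasing_lists n M"
        by (auto simp: decreasing_lists_def sorted_wrt_iff_nth_less)
    qed
    show "decreasing_lists n M \<subseteq> (\<lambda>l. map (beta_number n l) [0..<n]) ` ?P"
    proof
      fix L assume L: "L \<in> decreasing_lists n M"
      define r where "r = (\<lambda>i. L ! i - (n - 1 - i))"
      define l where "l = takeWhile (\<lambda>x. 0 < x) (map r [0..<n])"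
      have gap: "L ! k + (k - i) \<le> L ! i" if "i \<le> k" "k < n" for i k
        using decreasing_list_gap[of L i k] L that by (auto simp: decreasing_lists_def)
      \<comment> \<open>Strict decrease gives \<open>n - 1 - i \<le> L ! i\<close>, so the
        subtraction in \<open>r\<close> is not truncated.\<close>
      have L_eq: "L ! i = r i + (n - 1 - i)" if "i < n" for i
        using gap[of i "n - 1"] that unfolding r_def by linarith
      have anti: "r k \<le> r i" if "i \<le> k" "k < n" for i k
        using gap[OF that] L_eq[of i] L_eq[of k] that by simp
      have len: "length l \<le> n"
        using length_takeWhile_le[of _ "map r [0..<n]"] by (simp add: l_def)
      have nth: "l ! i = r i" if "i < length l" for i
        using that len takeWhile_nth[of i _ "map r [0..<n]"] by (simp add: l_def)
      have "r (length l) = 0" if "length l < n"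
        using nth_length_takeWhile[of "\<lambda>x. 0 < x" "map r [0..<n]"] that by (simp add: l_def)
      then have row: "row_length l i = r i" if "i < n" for i
        using anti[of "length l" i] that nth by (auto simp: row_length_def not_less)
      have pos: "\<forall>k\<in>set l. 0 < k" by (auto simp: l_def dest: set_takeWhileD)
      have "sorted_wrt (\<ge>) l"
        using len anti by (auto simp: sorted_wrt_iff_nth_less nth)
      with pos have "l \<in> partitions" by (simp add: partitions_def)
      moreover have "\<forall>k\<in>set l. k + n \<le> M"
      proof
        fix k assume "k \<in> set l"
        then obtain i where i: "i < length l" "k = r i" by (auto simp: in_set_conv_nth nth)
        then have "k \<le> r 0" "0 < n" using anti[of 0 i] len by auto
        moreover have "L ! 0 < M"
          using L \<open>0 < n\<close> nth_mem[of 0 L] unfolding decreasing_lists_def by blast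
        ultimately show "k + n \<le> M" using L_eq[of 0] by simp
      qed
      moreover have "L = map (beta_number n l) [0..<n]"
        using L L_eq row by (intro nth_equalityI) (auto simp: decreasing_lists_def beta_number_def)
      ultimately show "L \<in> (\<lambda>l. map (beta_number n l) [0..<n]) ` ?P"
        using len by blast
    qed
  qed
qed

subsection \<open>Congruence of power series\<close>

definition fps_cong :: "nat \<Rightarrow> 'a :: comm_ring_1 fps \<Rightarrow> 'a fps \<Rightarrow> bool" where
  "fps_cong M a b \<longleftrightarrow> (\<forall>k<M. fps_nth a k = fps_nth b k)"

lemma fps_cong_refl [simp]: "fps_cong M a a"
  by (simp add: fps_cong_def)

lemma fps_cong_add: "fps_cong M a b \<Longrightarrow> fps_cong M c d \<Longrightarrow> fps_cong M (a + c) (b + d)"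
  by (simp add: fps_cong_def)

lemma fps_cong_diff: "fps_cong M a b \<Longrightarrow> fps_cong M c d \<Longrightarrow> fps_cong M (a - c) (b - d)"
  by (simp add: fps_cong_def)

lemma fps_cong_mult: "fps_cong M a b \<Longrightarrow> fps_cong M c d \<Longrightarrow> fps_cong M (a * c) (b * d)"
  by (auto simp: fps_cong_def fps_mult_nth intro!: sum.cong)

lemma fps_cong_sum:
  "(\<And>x. x \<in> A \<Longrightarrow> fps_cong M (f x) (g x)) \<Longrightarrow> fps_cong M (sum f A) (sum g A)"
  by (induction A rule: infinite_finite_induct) (auto intro: fps_cong_add)

lemma fps_cong_prod:
  "(\<And>x. x \<in> A \<Longrightarrow> fps_cong M (f x) (g x)) \<Longrightarrow> fps_cong M (prod f A) (prod g A)"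
  by (induction A rule: infinite_finite_induct) (auto intro: fps_cong_mult)

text \<open>The Leibniz formula builds the determinant from sums and products, which respect
  congruence.\<close>

lemma fps_cong_det:
  assumes "\<And>i j. i < n \<Longrightarrow> j < n \<Longrightarrow> fps_cong M (f i j) (g i j)"
  shows "fps_cong M (det (mat n n (\<lambda>(i, j). f i j))) (det (mat n n (\<lambda>(i, j). g i j)))"
proof -
  have "fps_cong M (\<Sum>p | p permutes {0..<n}. signof p * (\<Prod>i=0..<n. f i (p i)))
      (\<Sum>p | p permutes {0..<n}. signof p * (\<Prod>i=0..<n. g i (p i)))"
  proof (intro fps_cong_sum fps_cong_mult fps_cong_refl fps_cong_prod)
    fix p i assume "p \<in> {p. p permutes {0..<n}}" "i \<in> {0..<n}"
    then have "p i < n" by (metis atLeastLessThan_iff mem_Collect_eq permutes_in_image)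
    with \<open>i \<in> {0..<n}\<close> show "fps_cong M (f i (p i)) (g i (p i))" using assms by simp
  qed
  moreover have "det (mat n n (\<lambda>(i, j). h i j)) =
      (\<Sum>p | p permutes {0..<n}. signof p * (\<Prod>i=0..<n. h i (p i)))" for h :: "nat \<Rightarrow> nat \<Rightarrow> 'a fps"
  proof (subst det_def'[of _ n])
    show "(\<Sum>p | p permutes {0..<n}. signof p *
        (\<Prod>i = 0..<n. mat n n (\<lambda>(i, j). h i j) $$ (i, p i))) =
      (\<Sum>p | p permutes {0..<n}. signof p * (\<Prod>i=0..<n. h i (p i)))"
      by (intro sum.cong arg_cong2[of _ _ _ _ "(*)"] prod.cong refl)
         (auto dest: permutes_in_image)
  qed simp
  ultimately show ?thesis by simp
qed

lemma fps_const_prod: "(\<Prod>x\<in>A. fps_const (f x)) = fps_const (\<Prod>x\<in>A. f x :: 'a :: comm_ring_1)"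
  by (induction A rule: infinite_finite_induct) auto

lemma fps_inverse_prod: "inverse (\<Prod>x\<in>A. f x) = (\<Prod>x\<in>A. inverse (f x :: 'a :: field fps))"
  by (induction A rule: infinite_finite_induct) (auto simp: fps_inverse_mult)

lemma prod_fps_nth_0: "fps_nth (\<Prod>x\<in>A. f x) 0 = (\<Prod>x\<in>A. fps_nth (f x :: 'a :: comm_ring_1 fps) 0)"
  by (induction A rule: infinite_finite_induct) auto

subsection \<open>The determinant of Euler's series\<close>

text \<open>The Pochhammer symbol \<open>(x;x)_l\<close>.\<close>

definition qpoch :: "nat \<Rightarrow> complex fps" where
  "qpoch l = (\<Prod>m=1..l. 1 - fps_X ^ m)"

lemma qpoch_Suc: "qpoch (Suc l) = qpoch l * (1 - fps_X ^ Suc l)"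
  by (simp add: qpoch_def)

lemma inverse_mult_qpoch [simp]: "inverse (qpoch l) * qpoch l = 1"
proof -
  have "fps_nth (qpoch l) 0 = 1"
    unfolding qpoch_def prod_fps_nth_0 by (intro prod.neutral) auto
  then show ?thesis by (intro inverse_mult_eq_1) simp
qed

text \<open>Writing the numerator as \<open>1 - (1 - fps_X ^ Suc l)\<close> cancels the last factor
  of the denominator. This difference form makes sums telescope.\<close>

lemma X_power_inverse_qpoch:
  "fps_X ^ Suc l * inverse (qpoch (Suc l)) = inverse (qpoch (Suc l)) - inverse (qpoch l)"
proof -
  have "inverse (qpoch l) * (inverse (qpoch (Suc l)) * qpoch (Suc l)) =
      inverse (qpoch (Suc l)) * (1 - fps_X ^ Suc l) * (inverse (qpoch l) * qpoch l)"
    by (simp only: qpoch_Suc mult_ac)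
  then have "inverse (qpoch l) = inverse (qpoch (Suc l)) * (1 - fps_X ^ Suc l)"
    by simp
  then show ?thesis by (simp add: algebra_simps)
qed

text \<open>Up to \<open>x\<^sup>M\<close>, the \<open>i\<close>-th divided derivative of \<open>E(z) = \<Sum>\<^sub>l z\<^sup>l / (x;x)\<^sub>l\<close>
  at \<open>z = x\<^sup>j\<^sup>+\<^sup>1\<close>, multiplied by \<open>z\<^sup>i\<close>.\<close>

definition euler_moment :: "nat \<Rightarrow> nat \<Rightarrow> nat \<Rightarrow> complex fps" where
  "euler_moment M i j =
    (\<Sum>l<M. of_nat (l choose i) * (fps_X ^ (l * Suc j) * inverse (qpoch l)))"

lemma euler_moment_0_0: "euler_moment (Suc m) 0 0 = inverse (qpoch m)"
proof (induction m)
  case 0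
  then show ?case by (simp add: euler_moment_def)
next
  case (Suc m)
  have "euler_moment (Suc (Suc m)) 0 0 = euler_moment (Suc m) 0 0 +
      fps_X ^ Suc m * inverse (qpoch (Suc m))"
    by (simp add: euler_moment_def)
  then show ?case by (simp only: Suc X_power_inverse_qpoch) simp
qed

text \<open>The functional equation \<open>E(x z) = (1 - z) E(z)\<close>.\<close>

lemma euler_moment_Suc:
  "euler_moment (Suc m) i (Suc j) + fps_X ^ Suc j *
      (euler_moment (Suc m) i j + (if i = 0 then 0 else euler_moment (Suc m) (i - 1) j)) =
    euler_moment (Suc m) i j +
      of_nat (Suc m choose i) * (fps_X ^ (Suc m * Suc j) * inverse (qpoch m))"
proof (induction m)
  case 0
  then show ?case
    by (cases i) (auto simp: euler_moment_def qpoch_def binomial_eq_0 intro: not_less_eq_eq)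
next
  case (Suc m)
  let ?l = "Suc m"
  define p where "p = (if i = 0 then 0 else of_nat (?l choose (i - 1)) :: complex fps)"
  have pascal: "of_nat (Suc ?l choose i) = of_nat (?l choose i) + p"
    by (cases i) (simp_all add: p_def)
  have step: "euler_moment (Suc ?l) i k = euler_moment ?l i k +
      of_nat (?l choose i) * (fps_X ^ (?l * Suc k) * inverse (qpoch ?l))" for i k
    by (simp add: euler_moment_def)
  have prev: "(if i = 0 then 0 else euler_moment (Suc ?l) (i - 1) j) =
      (if i = 0 then 0 else euler_moment ?l (i - 1) j) +
        p * (fps_X ^ (?l * Suc j) * inverse (qpoch ?l))"
    by (simp add: step p_def)
  \<comment> \<open>The subtracted part cancels the boundary term of the induction hypothesis, while
    \<open>pascal\<close> matches the new boundary term.\<close>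
  have split: "fps_X ^ (?l * Suc (Suc j)) * inverse (qpoch ?l) =
      fps_X ^ (?l * Suc j) * (inverse (qpoch ?l) - inverse (qpoch m))"
    by (simp only: X_power_inverse_qpoch[symmetric] mult.assoc[symmetric] power_add[symmetric])
       simp
  have pow: "fps_X ^ (Suc ?l * Suc j) = (fps_X ^ Suc j * fps_X ^ (?l * Suc j) :: complex fps)"
    by (simp only: power_add[symmetric] mult_Suc)
  show ?case
    using Suc.IH unfolding prev pascal pow step[of i] split
    by (simp only: algebra_simps) (simp only: add.assoc[symmetric] add_right_cancel)
qed

text \<open>The coefficient of \<open>\<epsilon>\<^sup>k\<close> in \<open>\<Prod>m=1..j. 1 - x\<^sup>m (1 + \<epsilon>)\<close>, which is the quotient
  \<open>E(x\<^sup>j z) / E(z)\<close> at \<open>z = x (1 + \<epsilon>)\<close>.\<close>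

fun newton_coeff :: "nat \<Rightarrow> nat \<Rightarrow> complex fps" where
  "newton_coeff k 0 = (if k = 0 then 1 else 0)"
| "newton_coeff k (Suc j) = (1 - fps_X ^ Suc j) * newton_coeff k j -
     fps_X ^ Suc j * (if k = 0 then 0 else newton_coeff (k - 1) j)"

lemma newton_coeff_eq_0: "j < k \<Longrightarrow> newton_coeff k j = 0"
  by (induction j arbitrary: k) auto

text \<open>The top coefficient in epsilon takes the term \<open>- (fps_X ^ m)\<close> from every
  factor.\<close>

lemma newton_coeff_diag: "newton_coeff j j = (\<Prod>m=1..j. - (fps_X ^ m))"
  by (induction j) (auto simp: newton_coeff_eq_0 mult.commute)

text \<open>Iterating the functional equation \<open>j\<close> times gives \<open>E(x^j z)\<close>
  as \<open>E(z)\<close> times the product encoded by \<open>newton_coeff\<close>; comparing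
  coefficients of epsilon gives a convolution, that is, a lower times an upper triangular
  matrix.\<close>

lemma euler_moment_cong:
  "fps_cong (Suc m) (euler_moment (Suc m) i j)
    (\<Sum>k\<le>i. euler_moment (Suc m) (i - k) 0 * newton_coeff k j)"
proof (induction j arbitrary: i)
  case 0
  have "(\<Sum>k\<le>i. euler_moment (Suc m) (i - k) 0 * newton_coeff k 0) = euler_moment (Suc m) i 0"
    by (simp add: if_distrib cong: if_cong)
  then show ?case by simp
next
  case (Suc j)
  let ?F = "euler_moment (Suc m)" and ?x = "fps_X ^ Suc j :: complex fps"
  let ?R = "of_nat (Suc m choose i) * (fps_X ^ (Suc m * Suc j) * inverse (qpoch m)) :: complex fps"
  \<comment> \<open>The boundary term of the truncation is divisible by
    \<open>fps_X ^ Suc m\<close>.\<close>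
  have R: "fps_cong (Suc m) ?R 0"
  proof -
    have "?R = fps_X ^ (Suc m * Suc j) * (of_nat (Suc m choose i) * inverse (qpoch m))"
      by (simp only: mult_ac)
    moreover have "Suc m \<le> Suc m * Suc j" by simp
    ultimately show ?thesis
      by (auto simp only: fps_cong_def fps_X_power_mult_nth fps_zero_nth split: if_splits)
  qed
  have prev: "fps_cong (Suc m) (if i = 0 then 0 else ?F (i - 1) j)
      (if i = 0 then 0 else \<Sum>k\<le>i - 1. ?F (i - 1 - k) 0 * newton_coeff k j)"
    by (cases i) (simp_all add: Suc.IH)
  have shift: "(\<Sum>k\<le>i. ?F (i - k) 0 * (if k = 0 then 0 else newton_coeff (k - 1) j)) =
      (if i = 0 then 0 else \<Sum>k\<le>i - 1. ?F (i - 1 - k) 0 * newton_coeff k j)"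
    by (cases i) (simp_all add: sum.atMost_Suc_shift del: sum.atMost_Suc)
  have "?F i (Suc j) =
      (1 - ?x) * ?F i j - ?x * (if i = 0 then 0 else ?F (i - 1) j) + ?R"
  proof -
    have "?F i (Suc j) =
        ?F i j + ?R - ?x * (?F i j + (if i = 0 then 0 else ?F (i - 1) j))"
      using euler_moment_Suc[of m i j] by (simp only: eq_diff_eq)
    then show ?thesis by (simp only: algebra_simps mult_1)
  qed
  moreover have "fps_cong (Suc m)
      ((1 - ?x) * ?F i j - ?x * (if i = 0 then 0 else ?F (i - 1) j) + ?R)
      ((1 - ?x) * (\<Sum>k\<le>i. ?F (i - k) 0 * newton_coeff k j) -
        ?x * (if i = 0 then 0 else \<Sum>k\<le>i - 1. ?F (i - 1 - k) 0 * newton_coeff k j) + 0)"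
    by (intro fps_cong_add fps_cong_diff fps_cong_mult fps_cong_refl R Suc.IH prev)
  moreover have "(1 - ?x) * (\<Sum>k\<le>i. ?F (i - k) 0 * newton_coeff k j) -
        ?x * (if i = 0 then 0 else \<Sum>k\<le>i - 1. ?F (i - 1 - k) 0 * newton_coeff k j) + 0 =
      (\<Sum>k\<le>i. ?F (i - k) 0 * newton_coeff k (Suc j))"
    unfolding shift[symmetric] newton_coeff.simps
    by (simp only: sum_distrib_left sum_subtractf[symmetric] add_0_right)
       (simp only: algebra_simps mult_1)
  ultimately show ?case by simp
qed

text \<open>Each \<open>m\<close> is counted once for every \<open>j\<close> with
  \<open>m \<le> j < n\<close>, hence \<open>n - m\<close> times; then set \<open>m = Suc i\<close>.
  It matches the power of \<open>x\<close> in the determinant with the staircase constant of the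
  beta numbers.\<close>

lemma sum_triangular: "(\<Sum>j<n. \<Sum>m=1..j. m) = (\<Sum>i<n. Suc i * (n - 1 - i))"
proof (induction n)
  case (Suc n)
  have "(\<Sum>i<Suc n. Suc i * (Suc n - 1 - i)) = (\<Sum>i<n. Suc i * (n - i))" by simp
  also have "\<dots> = (\<Sum>i<n. Suc i * (n - 1 - i) + Suc i)"
  proof (intro sum.cong refl)
    fix i assume "i \<in> {..<n}"
    then have "n - i = Suc (n - 1 - i)" by auto
    then show "Suc i * (n - i) = Suc i * (n - 1 - i) + Suc i" by simp
  qed
  also have "\<dots> = (\<Sum>i<n. Suc i * (n - 1 - i)) + (\<Sum>m=1..n. m)"
    by (simp only: sum.distrib) (simp add: sum.atLeast1_atMost_eq)
  finally show ?case using Suc.IH by simp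
qed simp

lemma det_euler_moment:
  "fps_cong (Suc m) (det (mat n n (\<lambda>(i, j). euler_moment (Suc m) i j)))
    ((- 1) ^ (\<Sum>j<n. j) * fps_X ^ (\<Sum>i<n. Suc i * (n - 1 - i)) * inverse (qpoch m) ^ n)"
proof -
  \<comment> \<open>The lower triangular factor, with constant diagonal
    \<open>euler_moment (Suc m) 0 0 = inverse (qpoch m)\<close>.\<close>
  define T where "T = (\<lambda>i k. if k \<le> i then euler_moment (Suc m) (i - k) 0 else 0)"
  have "fps_cong (Suc m) (det (mat n n (\<lambda>(i, j). euler_moment (Suc m) i j)))
      (det (mat n n (\<lambda>(i, j). \<Sum>k<n. T i k * newton_coeff k j)))"
  proof (rule fps_cong_det)
    fix i j assume "i < n" "j < n"
    then have "(\<Sum>k<n. T i k * newton_coeff k j) =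
        (\<Sum>k\<le>i. euler_moment (Suc m) (i - k) 0 * newton_coeff k j)"
      by (intro sum.mono_neutral_cong_right) (auto simp: T_def)
    then show "fps_cong (Suc m) (euler_moment (Suc m) i j) (\<Sum>k<n. T i k * newton_coeff k j)"
      using euler_moment_cong by simp
  qed
  moreover have "det (mat n n (\<lambda>(i, j). T i j)) = inverse (qpoch m) ^ n"
    by (subst det_lower_triangular_mat) (auto simp: T_def euler_moment_0_0)
  moreover have "det (mat n n (\<lambda>(k, j). newton_coeff k j)) =
      (- 1) ^ (\<Sum>j<n. j) * fps_X ^ (\<Sum>i<n. Suc i * (n - 1 - i))"
  proof -
    have "det (mat n n (\<lambda>(k, j). newton_coeff k j)) = (\<Prod>j<n. \<Prod>m=1..j. (- 1) * fps_X ^ m)"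
      by (subst det_upper_triangular_mat) (auto simp: newton_coeff_eq_0 newton_coeff_diag)
    also have "\<dots> = (\<Prod>j<n. (- 1) ^ j * fps_X ^ (\<Sum>m=1..j. m))"
      by (simp only: prod.distrib power_sum) simp
    also have "\<dots> = (- 1) ^ (\<Sum>j<n. j) * fps_X ^ (\<Sum>j<n. \<Sum>m=1..j. m)"
      by (simp only: prod.distrib power_sum)
    finally show ?thesis by (simp only: sum_triangular)
  qed
  ultimately show ?thesis
    by (simp only: det_mat_mult mult.commute[of "inverse (qpoch m) ^ n"])
qed

section \<open>Evaluation of the binomial and the power determinant\<close>

lemma of_nat_fact_binomial:
  "of_nat (fact i * (b choose i)) = (\<Prod>m<i. of_nat b - of_nat m :: 'a :: comm_ring_1)"
proof (induction i)
  case (Suc i)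
  have "Suc i * (b choose Suc i) = (b - i) * (b choose i)"
    by (simp only: binomial_absorption binomial_absorb_comp)
  then have "fact i * (Suc i * (b choose Suc i)) = fact i * ((b - i) * (b choose i))"
    by (simp only:)
  then have "fact (Suc i) * (b choose Suc i) = (b - i) * (fact i * (b choose i))"
    by (simp only: fact_Suc of_nat_id mult_ac)
  \<comment> \<open>For \<open>i > b\<close> the truncated difference is wrong, but then
    \<open>b choose i\<close> is zero.\<close>
  moreover have "of_nat ((b - i) * (fact i * (b choose i))) =
      (of_nat b - of_nat i) * (of_nat (fact i * (b choose i)) :: 'a)"
    by (cases "i \<le> b") (simp_all add: of_nat_diff binomial_eq_0)
  ultimately show ?case by (simp only: Suc.IH) (simp add: mult.commute)
qed simp

text \<open>Multiplying row \<open>i\<close> by \<open>fact i\<close> turns binomials into falling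
  factorials, the Newton basis with nodes 0, 1, 2 and so on.\<close>

lemma det_binomial:
  "of_nat (\<Prod>i<n. fact i) * det (mat n n (\<lambda>(i, k). of_nat (b k choose i))) =
    (\<Prod>j<n. \<Prod>k<j. of_nat (b j) - of_nat (b k) :: 'a :: comm_ring_1)"
proof -
  have "of_nat (\<Prod>i<n. fact i) * det (mat n n (\<lambda>(i, k). of_nat (b k choose i))) =
      det (mat n n (\<lambda>(i, k). of_nat (fact i) * (of_nat (b k choose i) :: 'a)))"
    by (simp only: det_scale_rows of_nat_prod)
  also have "\<dots> = det (transpose_mat (mat n n (\<lambda>(k, i). \<Prod>m<i. of_nat (b k) - of_nat m)))"
    by (intro arg_cong[of _ _ det] eq_matI)
       (auto simp: of_nat_fact_binomial[symmetric])
  also have "\<dots> = (\<Prod>j<n. \<Prod>k<j. of_nat (b j) - of_nat (b k))"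
    by (subst det_transpose[of _ n]) (auto simp: det_newton_vandermonde)
  finally show ?thesis .
qed

text \<open>After a factor is taken out of each row, this is an ordinary Vandermonde determinant in
  the powers \<open>fps_X ^ b k\<close>.\<close>

lemma det_powers:
  assumes "\<And>j k. k < j \<Longrightarrow> j < n \<Longrightarrow> b j < b k"
  shows "det (mat n n (\<lambda>(k, j). fps_X ^ (b k * Suc j) * inverse (qpoch (b k)))) =
    fps_X ^ (\<Sum>j<n. Suc j * b j) * inverse (\<Prod>k<n. qpoch (b k)) *
      (\<Prod>j<n. \<Prod>k<j. 1 - fps_X ^ (b k - b j))"
proof -
  \<comment> \<open>The subtracted zeros put the power in Newton form with all nodes 0.\<close>
  have entry: "fps_X ^ (b k * Suc j) * inverse (qpoch (b k)) =
      (fps_X ^ b k * inverse (qpoch (b k))) * (\<Prod>m<j. fps_X ^ b k - 0)" for k j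
    unfolding power_mult power_Suc diff_0_right prod_constant card_lessThan by (simp only: mult_ac)
  have "det (mat n n (\<lambda>(k, j). fps_X ^ (b k * Suc j) * inverse (qpoch (b k)))) =
      det (mat n n (\<lambda>(k, j). (fps_X ^ b k * inverse (qpoch (b k))) * (\<Prod>m<j. fps_X ^ b k - 0)))"
    by (simp only: entry)
  also have "\<dots> = (\<Prod>k<n. fps_X ^ b k * inverse (qpoch (b k))) *
      (\<Prod>j<n. \<Prod>k<j. fps_X ^ b j - fps_X ^ b k)"
    by (simp only: det_scale_rows det_newton_vandermonde)
  \<comment> \<open>The smaller power is extracted \<open>j\<close> times; with the row factor it
    yields the weight \<open>Suc j * b j\<close>.\<close>
  also have "(\<Prod>j<n. \<Prod>k<j. fps_X ^ b j - fps_X ^ b k) =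
      (\<Prod>j<n. \<Prod>k<j. fps_X ^ b j * (1 - fps_X ^ (b k - b j)) :: complex fps)"
  proof (intro prod.cong refl)
    fix j k assume "j \<in> {..<n}" "k \<in> {..<j}"
    then have "b k = b j + (b k - b j)" using assms[of k j] by simp
    then have "fps_X ^ b k = (fps_X ^ b j * fps_X ^ (b k - b j) :: complex fps)"
      by (metis power_add)
    then show "fps_X ^ b j - fps_X ^ b k =
        (fps_X ^ b j * (1 - fps_X ^ (b k - b j)) :: complex fps)"
      by (simp add: algebra_simps)
  qed
  also have "\<dots> = (\<Prod>j<n. fps_X ^ (j * b j)) * (\<Prod>j<n. \<Prod>k<j. 1 - fps_X ^ (b k - b j))"
    by (simp only: prod.distrib prod_constant card_lessThan power_mult[symmetric] mult.commute)
  also have "(\<Prod>k<n. fps_X ^ b k * inverse (qpoch (b k))) *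
      ((\<Prod>j<n. fps_X ^ (j * b j)) * (\<Prod>j<n. \<Prod>k<j. 1 - fps_X ^ (b k - b j))) =
    (\<Prod>j<n. fps_X ^ (Suc j * b j)) * (\<Prod>k<n. inverse (qpoch (b k))) *
      (\<Prod>j<n. \<Prod>k<j. 1 - fps_X ^ (b k - b j))"
    by (simp add: prod.distrib power_add mult_ac)
  finally show ?thesis by (simp only: power_sum fps_inverse_prod)
qed

subsection \<open>Hook terms at negative integers\<close>

lemma finite_boxes: "finite (boxes l)"
  by (rule finite_subset[of _ "SIGMA i:{1..length l}. {1..part l i}"]) (auto simp: boxes_def)

lemma hook_term_altdef:
  "hook_term \<beta> l = fps_X ^ (sum_list l + b_stat l) *
     fps_const ((\<Prod>v\<in>boxes l. of_int (content v) - \<beta>) / (\<Prod>v\<in>boxes l. of_nat (hook_length l v))) *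
     inverse (\<Prod>v\<in>boxes l. 1 - fps_X ^ hook_length l v)"
  by (simp only: hook_term_def prod.distrib fps_const_prod prod_dividef fps_inverse_prod mult.assoc)

lemma prod_atLeast1_fact: "(\<Prod>m=1..k. of_nat m) = (fact k :: 'a :: {comm_semiring_1, semiring_char_0})"
  by (simp add: fact_prod)

text \<open>The identities for hooks and contents turn both quotients of the hook term into
  difference products of beta numbers, which are the two determinants up to sign and factors that
  cancel.\<close>

lemma hook_term_eq_det:
  assumes l: "l \<in> partitions" and n: "length l \<le> n"
  defines "L \<equiv> map (beta_number n l) [0..<n]"
  shows "(- 1) ^ (\<Sum>j<n. j) * fps_X ^ (\<Sum>i<n. Suc i * (n - 1 - i)) * hook_term (- of_nat n) l =
    det (mat n n (\<lambda>(i, k). of_nat (L ! k choose i))) *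
    det (mat n n (\<lambda>(k, j). fps_X ^ (L ! k * Suc j) * inverse (qpoch (L ! k))))"
proof -
  define b where "b = beta_number n l"
  define H where "H = (\<Prod>v\<in>boxes l. of_nat (hook_length l v) :: complex)"
  define Hx where "Hx = (\<Prod>v\<in>boxes l. 1 - fps_X ^ hook_length l v :: complex fps)"
  define C where "C = (\<Prod>v\<in>boxes l. of_int (content v) + of_nat n :: complex)"
  define D where "D = (\<Prod>j<n. \<Prod>k<j. of_nat (b k - b j) :: complex)"
  define Dx where "Dx = (\<Prod>j<n. \<Prod>k<j. 1 - fps_X ^ (b k - b j) :: complex fps)"
  define Q where "Q = (\<Prod>k<n. qpoch (b k))"
  define F where "F = (\<Prod>i<n. fact i :: complex)"
  define e where "e = (\<Sum>j<n. Suc j * b j)"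
  define s where "s = (- 1 :: complex fps) ^ (\<Sum>j<n. j)"
  have dec: "b j < b k" if "k < j" "j < n" for j k
    using row_length_antimono[OF l, of k j] that by (simp add: b_def beta_number_def)
  have nth: "L ! k = b k" if "k < n" for k using that by (simp add: L_def b_def)
  have HD: "H * D = (\<Prod>i<n. fact (b i))"
    unfolding H_def D_def b_def
    using prod_hook_length[OF l n, of "of_nat :: nat \<Rightarrow> complex"]
    by (simp only: prod_atLeast1_fact)
  have HDx: "Hx * Dx = Q"
    unfolding Hx_def Dx_def b_def Q_def qpoch_def by (rule prod_hook_length[OF l n])
  have CF: "C * F = (\<Prod>i<n. fact (b i))"
    unfolding C_def F_def b_def by (rule prod_content[OF n])
  have H0: "H \<noteq> 0"
    unfolding H_def by (auto simp: prod_zero_iff finite_boxes hook_length_def)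
  have F0: "F \<noteq> 0" by (simp add: F_def)
  \<comment> \<open>Both \<open>H * D\<close> and \<open>C * F\<close> equal the product of the
    factorials of the beta numbers.\<close>
  have CH: "C / H = D / F" using HD CF H0 F0 by (simp add: frac_eq_eq mult.commute)
  have "fps_nth Hx 0 = 1"
    unfolding Hx_def prod_fps_nth_0 by (intro prod.neutral) (auto simp: hook_length_def)
  then have invHx: "inverse Hx * Hx = 1" by (intro inverse_mult_eq_1) simp
  have "inverse Q = inverse Hx * inverse Dx" by (simp add: fps_inverse_mult flip: HDx)
  moreover have "fps_nth Dx 0 = 1"
    unfolding Dx_def prod_fps_nth_0
  proof (intro prod.neutral ballI)
    fix j k assume "j \<in> {..<n}" "k \<in> {..<j}"
    then show "fps_nth (1 - fps_X ^ (b k - b j) :: complex fps) 0 = 1" using dec[of k j] by simp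
  qed
  then have "inverse Dx * Dx = 1" by (intro inverse_mult_eq_1) simp
  ultimately have Hx: "inverse Hx = inverse Q * Dx" by (simp add: mult.assoc)
  have "F = of_nat (\<Prod>i<n. fact i)" by (simp add: F_def)
  then have "fps_const F = of_nat (\<Prod>i<n. fact i)" by (simp only: fps_of_nat)
  then have "fps_const F * det (mat n n (\<lambda>(i, k). of_nat (b k choose i))) =
      (\<Prod>j<n. \<Prod>k<j. of_nat (b j) - of_nat (b k))"
    by (simp only: det_binomial)
  \<comment> \<open>Since \<open>b j < b k\<close>, every pair contributes a sign; together they
    form \<open>s\<close>.\<close>
  also have "\<dots> = (\<Prod>j<n. \<Prod>k<j. (- 1) * fps_const (of_nat (b k - b j)))"
  proof (intro prod.cong refl)
    fix j k assume "j \<in> {..<n}" "k \<in> {..<j}"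
    then have "b j \<le> b k" using dec[of k j] by simp
    then show "of_nat (b j) - of_nat (b k) =
        (- 1) * (fps_const (of_nat (b k - b j)) :: complex fps)"
      by (simp add: of_nat_diff flip: fps_of_nat)
  qed
  also have "\<dots> = s * fps_const D"
    by (simp only: prod.distrib fps_const_prod prod_constant card_lessThan power_sum s_def D_def)
  finally have FA: "fps_const F * det (mat n n (\<lambda>(i, k). of_nat (b k choose i))) = s * fps_const D" .
  have detA: "det (mat n n (\<lambda>(i, k). of_nat (b k choose i))) = s * fps_const (D / F)"
  proof -
    have "fps_const (1 / F) * fps_const F = 1" using F0 by simp
    then have "det (mat n n (\<lambda>(i, k). of_nat (b k choose i))) =
        fps_const (1 / F) * (fps_const F * det (mat n n (\<lambda>(i, k). of_nat (b k choose i))))"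
      by (metis mult.assoc mult_1)
    also have "\<dots> = s * (fps_const (1 / F) * fps_const D)" unfolding FA by (simp only: mult_ac)
    finally show ?thesis by simp
  qed
  have detB: "det (mat n n (\<lambda>(k, j). fps_X ^ (b k * Suc j) * inverse (qpoch (b k)))) =
      fps_X ^ e * inverse Q * Dx"
    unfolding e_def Q_def Dx_def by (rule det_powers) (rule dec)
  have "hook_term (- of_nat n) l =
      fps_X ^ (sum_list l + b_stat l) * fps_const (C / H) * inverse Hx"
    unfolding hook_term_altdef C_def H_def Hx_def by simp
  then have "s * fps_X ^ (\<Sum>i<n. Suc i * (n - 1 - i)) * hook_term (- of_nat n) l =
      fps_X ^ (sum_list l + b_stat l + (\<Sum>i<n. Suc i * (n - 1 - i))) *
      (s * fps_const (D / F) * (inverse Q * Dx))"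
    unfolding CH Hx by (simp only: power_add mult_ac)
  also have "\<dots> = (s * fps_const (D / F)) * (fps_X ^ e * inverse Q * Dx)"
    unfolding size_b_stat_beta_number[OF n] e_def b_def by (simp only: mult_ac)
  also have "\<dots> = det (mat n n (\<lambda>(i, k). of_nat (b k choose i))) *
      det (mat n n (\<lambda>(k, j). fps_X ^ (b k * Suc j) * inverse (qpoch (b k))))"
    by (simp only: detA detB)
  also have "mat n n (\<lambda>(i, k). of_nat (b k choose i)) =
      (mat n n (\<lambda>(i, k). of_nat (L ! k choose i)) :: complex fps mat)"
    by (rule eq_matI) (auto simp: nth)
  also have "mat n n (\<lambda>(k, j). fps_X ^ (b k * Suc j) * inverse (qpoch (b k))) =
      mat n n (\<lambda>(k, j). fps_X ^ (L ! k * Suc j) * inverse (qpoch (L ! k)))"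
    by (rule eq_matI) (auto simp: nth)
  finally show ?thesis by (simp only: s_def)
qed

text \<open>The first box of row \<open>n + 1\<close> has content \<open>- n\<close>, so its factor
  vanishes.\<close>

lemma hook_term_eq_0:
  assumes l: "l \<in> partitions" and n: "n < length l"
  shows "hook_term (- of_nat n) l = 0"
proof -
  have "(Suc n, 1) \<in> boxes l"
    using l n nth_mem[of n l] by (auto simp: boxes_def part_def partitions_def Suc_le_eq)
  moreover have "of_int (content (Suc n, 1)) - (- of_nat n) = (0 :: complex)"
    by (simp add: content_def)
  ultimately have "(\<Prod>v\<in>boxes l. of_int (content v) - (- of_nat n)) = (0 :: complex)"
    using finite_boxes by (intro prod_zero) blast+
  then show ?thesis unfolding hook_term_altdef by simp
qed

lemma hook_term_nth_eq_0:
  assumes "N < sum_list l"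
  shows "fps_nth (hook_term \<beta> l) N = 0"
  using assms by (simp add: hook_term_altdef mult.assoc fps_X_power_mult_nth)

text \<open>Cauchy--Binet sums the determinant products. The power of \<open>x\<close> stays on both
  sides, since cancelling it would lower the precision of the congruence.\<close>

lemma sum_hook_term_cong:
  assumes "n \<le> Suc m"
  shows "fps_cong (Suc m)
    (fps_X ^ (\<Sum>i<n. Suc i * (n - 1 - i)) *
      (\<Sum>l | l \<in> partitions \<and> length l \<le> n \<and> (\<forall>k\<in>set l. k + n \<le> Suc m). hook_term (- of_nat n) l))
    (fps_X ^ (\<Sum>i<n. Suc i * (n - 1 - i)) * inverse (qpoch m) ^ n)"
proof -
  let ?P = "{l \<in> partitions. length l \<le> n \<and> (\<forall>k\<in>set l. k + n \<le> Suc m)}"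
  let ?A = "\<lambda>i l. of_nat (l choose i) :: complex fps"
  let ?B = "\<lambda>l j. fps_X ^ (l * Suc j) * inverse (qpoch l)"
  define s where "s = (- 1 :: complex fps) ^ (\<Sum>j<n. j)"
  define x where "x = (fps_X :: complex fps) ^ (\<Sum>i<n. Suc i * (n - 1 - i))"
  \<comment> \<open>The sign is its own inverse, so multiplying by it once more removes it.\<close>
  have "s * s = 1" by (simp add: s_def flip: power_add mult_2)
  then have ss: "s * (s * y) = y" for y by (simp flip: mult.assoc)
  have "s * (x * (\<Sum>l\<in>?P. hook_term (- of_nat n) l)) =
      (\<Sum>l\<in>?P. s * x * hook_term (- of_nat n) l)"
    by (simp only: sum_distrib_left mult.assoc)
  also have "\<dots> = (\<Sum>l\<in>?P. (\<lambda>L. det (mat n n (\<lambda>(i, k). ?A i (L ! k))) *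
      det (mat n n (\<lambda>(k, j). ?B (L ! k) j))) (map (beta_number n l) [0..<n]))"
    unfolding s_def x_def by (intro sum.cong refl hook_term_eq_det) auto
  also have "\<dots> = (\<Sum>L\<in>decreasing_lists n (Suc m).
      det (mat n n (\<lambda>(i, k). ?A i (L ! k))) * det (mat n n (\<lambda>(k, j). ?B (L ! k) j)))"
    by (rule sum.reindex_bij_betw[OF bij_betw_beta_numbers[OF assms]])
  also have "\<dots> = det (mat n n (\<lambda>(i, j). euler_moment (Suc m) i j))"
    unfolding euler_moment_def by (rule cauchy_binet[symmetric])
  finally have "fps_cong (Suc m) (s * (x * (\<Sum>l\<in>?P. hook_term (- of_nat n) l)))
      (s * x * inverse (qpoch m) ^ n)"
    using det_euler_moment[of m n] by (simp only: s_def x_def)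
  then have "fps_cong (Suc m) (s * (s * (x * (\<Sum>l\<in>?P. hook_term (- of_nat n) l))))
      (s * (s * x * inverse (qpoch m) ^ n))"
    by (rule fps_cong_mult[OF fps_cong_refl])
  then show ?thesis
    by (simp only: mult.assoc ss x_def)
qed

subsection \<open>Coefficients as polynomials in the exponent\<close>

definition small_partitions :: "nat \<Rightarrow> nat list set" where
  "small_partitions N = {l \<in> partitions. sum_list l \<le> N}"

lemma length_le_sum_list: "\<forall>k\<in>set l. 0 < k \<Longrightarrow> length l \<le> sum_list (l :: nat list)"
  by (induction l) auto

lemma finite_small_partitions: "finite (small_partitions N)"
proof (rule finite_subset)
  show "small_partitions N \<subseteq> {l. set l \<subseteq> {..N} \<and> length l \<le> N}"
  proof clarify
    fix l assume l: "l \<in> small_partitions N"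
    then have "length l \<le> sum_list l"
      by (intro length_le_sum_list) (auto simp: small_partitions_def partitions_def)
    moreover have "k \<le> N" if "k \<in> set l" for k
      using member_le_sum_list[OF that] l by (simp add: small_partitions_def)
    ultimately show "set l \<subseteq> {..N} \<and> length l \<le> N"
      using l by (auto simp: small_partitions_def)
  qed
  show "finite {l. set l \<subseteq> {..N} \<and> length l \<le> N}" by (rule finite_lists_length_le) simp
qed

text \<open>The bound on \<open>m\<close> keeps the coefficient read off after the shift within the
  range of the congruence and admits all partitions of size at most \<open>N\<close> with at most
  \<open>n\<close> rows.\<close>

lemma sum_hook_term_nth_neg:
  assumes m: "N + (\<Sum>i<n. Suc i * (n - 1 - i)) + n \<le> m"
  shows "(\<Sum>l\<in>small_partitions N. fps_nth (hook_term (- of_nat n) l) N) =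
    fps_nth (inverse (qpoch m) ^ n) N"
proof -
  let ?P = "{l \<in> partitions. length l \<le> n \<and> (\<forall>k\<in>set l. k + n \<le> Suc m)}"
  let ?t = "\<lambda>l. fps_nth (hook_term (- of_nat n) l) N"
  let ?S = "{l \<in> small_partitions N. length l \<le> n}"
  define e where "e = (\<Sum>i<n. Suc i * (n - 1 - i))"
  have "finite ?P"
    using bij_betw_finite[OF bij_betw_beta_numbers[of n "Suc m"]] finite_decreasing_lists m by auto
  have "(\<Sum>l\<in>small_partitions N. ?t l) = (\<Sum>l\<in>?S. ?t l)"
  proof (rule sum.mono_neutral_right[OF finite_small_partitions])
    show "\<forall>l\<in>small_partitions N - ?S. ?t l = 0"
    proof
      fix l assume "l \<in> small_partitions N - ?S"
      then have "l \<in> partitions" "n < length l" by (auto simp: small_partitions_def)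
      then show "?t l = 0" by (simp add: hook_term_eq_0)
    qed
  qed auto
  also have "\<dots> = (\<Sum>l\<in>?P. ?t l)"
  proof (rule sum.mono_neutral_left[OF \<open>finite ?P\<close>])
    show "?S \<subseteq> ?P"
    proof clarify
      fix l assume l: "l \<in> small_partitions N" "length l \<le> n"
      have "k + n \<le> Suc m" if "k \<in> set l" for k
        using member_le_sum_list[OF that] l m by (simp add: small_partitions_def)
      with l show "l \<in> partitions \<and> length l \<le> n \<and> (\<forall>k\<in>set l. k + n \<le> Suc m)"
        by (auto simp: small_partitions_def)
    qed
    show "\<forall>l\<in>?P - ?S. ?t l = 0"
      by (auto simp: small_partitions_def not_le intro: hook_term_nth_eq_0)
  qed
  also have "\<dots> = fps_nth (\<Sum>l\<in>?P. hook_term (- of_nat n) l) N" by (simp add: fps_sum_nth)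
  also have "\<dots> = fps_nth (fps_X ^ e * (\<Sum>l\<in>?P. hook_term (- of_nat n) l)) (N + e)"
    by (simp add: fps_X_power_mult_nth)
  also have "\<dots> = fps_nth (fps_X ^ e * inverse (qpoch m) ^ n) (N + e)"
    using sum_hook_term_cong[of n m] m unfolding fps_cong_def e_def by auto
  also have "\<dots> = fps_nth (inverse (qpoch m) ^ n) N"
    by (simp add: fps_X_power_mult_nth)
  finally show ?thesis .
qed

section \<open>Binomial series: negative integer exponents and stable coefficients\<close>

lemma binomial_series_neg:
  assumes "0 < m"
  shows "binomial_series m (- of_nat n) = inverse (1 - fps_X ^ m) ^ n"
proof -
  have 0: "fps_nth (- (fps_X ^ m)) 0 = (0 :: complex)" using assms by simp
  have "binomial_series m (- of_nat n) = inverse ((1 + fps_X) ^ n oo - (fps_X ^ m))"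
    unfolding binomial_series_def fps_binomial_minus_of_nat
    using 0 by (intro fps_inverse_compose) auto
  also have "(1 + fps_X) ^ n oo - (fps_X ^ m) = (1 - fps_X ^ m :: complex fps) ^ n"
    by (simp add: fps_compose_power[OF 0, symmetric] fps_compose_add_distrib
          fps_X_fps_compose_startby0[OF 0])
  finally show ?thesis by (simp add: fps_inverse_power)
qed

lemma prod_binomial_series_neg:
  "(\<Prod>m\<le>k. binomial_series (Suc m) (- of_nat n)) = inverse (qpoch (Suc k)) ^ n"
proof -
  have "(\<Prod>m\<le>k. binomial_series (Suc m) (- of_nat n)) =
      (\<Prod>m\<le>k. inverse (1 - fps_X ^ Suc m)) ^ n"
    by (simp only: binomial_series_neg[OF zero_less_Suc] prod_power_distrib)
  also have "(\<Prod>m\<le>k. inverse (1 - fps_X ^ Suc m)) = inverse (qpoch (Suc k))"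
    unfolding qpoch_def fps_inverse_prod
    by (rule prod.reindex_bij_witness[of _ "\<lambda>m. m - 1" Suc]) auto
  finally show ?thesis .
qed

lemma binomial_series_nth:
  "fps_nth (binomial_series m \<beta>) N =
    (\<Sum>i=0..N. (\<beta> gchoose i) * fps_nth ((- (fps_X ^ m)) ^ i) N)"
  by (simp add: binomial_series_def fps_compose_nth)

lemma binomial_series_cong: "fps_cong m (binomial_series m \<beta>) 1"
  unfolding fps_cong_def
proof (intro allI impI)
  fix k assume k: "k < m"
  have "fps_nth ((- (fps_X ^ m)) ^ i) k = (if i = 0 then fps_nth 1 k else 0 :: complex)" for i
  proof (cases i)
    case (Suc i')
    have "(- (fps_X ^ m)) ^ i = fps_X ^ m * (- ((- (fps_X ^ m)) ^ i') :: complex fps)"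
      by (simp add: Suc)
    with k Suc show ?thesis by (simp only: fps_X_power_mult_nth) simp
  qed simp
  then show "fps_nth (binomial_series m \<beta>) k = fps_nth 1 k"
    unfolding binomial_series_nth by (simp add: if_distrib cong: if_cong)
qed

text \<open>The factor added after index \<open>k\<close> is 1 modulo \<open>x^(k+2)\<close>, so it
  leaves the coefficient of \<open>x^N\<close> alone.\<close>

lemma prod_binomial_series_stable:
  assumes "N \<le> k"
  shows "fps_nth (\<Prod>m\<le>k. binomial_series (Suc m) \<beta>) N = fps_nth (\<Prod>m\<le>N. binomial_series (Suc m) \<beta>) N"
  using assms
proof (induction k rule: dec_induct)
  case (step k)
  have "fps_cong (Suc (Suc k)) ((\<Prod>m\<le>k. binomial_series (Suc m) \<beta>) * binomial_series (Suc (Suc k)) \<beta>)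
      ((\<Prod>m\<le>k. binomial_series (Suc m) \<beta>) * 1)"
    by (intro fps_cong_mult fps_cong_refl binomial_series_cong)
  with step show ?case by (simp add: fps_cong_def)
qed simp

definition polyfun :: "('a :: field \<Rightarrow> 'a) \<Rightarrow> bool" where
  "polyfun f \<longleftrightarrow> (\<exists>p. \<forall>x. f x = poly p x)"

lemma polyfun_const: "polyfun (\<lambda>_. c)"
  unfolding polyfun_def by (rule exI[of _ "[:c:]"]) simp

lemma polyfun_id: "polyfun (\<lambda>x. x)"
  unfolding polyfun_def by (rule exI[of _ "[:0, 1:]"]) simp

lemma polyfun_add: "polyfun f \<Longrightarrow> polyfun g \<Longrightarrow> polyfun (\<lambda>x. f x + g x)"
  unfolding polyfun_def by (metis poly_add)

lemma polyfun_diff: "polyfun f \<Longrightarrow> polyfun g \<Longrightarrow> polyfun (\<lambda>x. f x - g x)"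
  unfolding polyfun_def by (metis poly_diff)

lemma polyfun_mult: "polyfun f \<Longrightarrow> polyfun g \<Longrightarrow> polyfun (\<lambda>x. f x * g x)"
  unfolding polyfun_def by (metis poly_mult)

lemma polyfun_divide_const: "polyfun f \<Longrightarrow> polyfun (\<lambda>x. f x / c)"
  using polyfun_mult[OF _ polyfun_const[of "1 / c"], of f] by simp

lemma polyfun_sum: "(\<And>a. a \<in> A \<Longrightarrow> polyfun (f a)) \<Longrightarrow> polyfun (\<lambda>x. \<Sum>a\<in>A. f a x)"
  by (induction A rule: infinite_finite_induct) (auto intro: polyfun_const polyfun_add)

lemma polyfun_prod: "(\<And>a. a \<in> A \<Longrightarrow> polyfun (f a)) \<Longrightarrow> polyfun (\<lambda>x. \<Prod>a\<in>A. f a x)"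
  by (induction A rule: infinite_finite_induct) (auto intro: polyfun_const polyfun_mult)

lemma polyfun_prod_nth:
  assumes "\<And>a k. a \<in> A \<Longrightarrow> polyfun (\<lambda>x. fps_nth (f a x) k)"
  shows "polyfun (\<lambda>x. fps_nth (\<Prod>a\<in>A. f a x) N)"
  using assms
proof (induction A arbitrary: N rule: infinite_finite_induct)
  case (insert a A)
  have "polyfun (\<lambda>x. \<Sum>i=0..N. fps_nth (f a x) i * fps_nth (\<Prod>a\<in>A. f a x) (N - i))"
    using insert by (intro polyfun_sum polyfun_mult) auto
  with insert show ?case by (simp add: fps_mult_nth)
qed (auto intro: polyfun_const)

text \<open>In characteristic 0 the points \<open>- of_nat n\<close> are infinitely many, and a
  nonzero polynomial has only finitely many roots.\<close>

lemma polyfun_eqI: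
  fixes f g :: "'a :: field_char_0 \<Rightarrow> 'a"
  assumes "polyfun f" "polyfun g" "\<And>n. f (- of_nat n) = g (- of_nat n)"
  shows "f x = g x"
proof -
  obtain p q where p: "\<And>x. f x = poly p x" and q: "\<And>x. g x = poly q x"
    using assms by (auto simp: polyfun_def)
  have "infinite (range (\<lambda>n. - of_nat n :: 'a))"
    by (rule range_inj_infinite) (auto intro: injI)
  moreover have "range (\<lambda>n. - of_nat n) \<subseteq> {x. poly (p - q) x = 0}"
    using assms(3) p q by auto
  ultimately have "infinite {x. poly (p - q) x = 0}" using finite_subset by blast
  then have "p - q = 0" using poly_roots_finite[of "p - q"] by blast
  then show ?thesis by (simp add: p q)
qed

lemma polyfun_binomial_series: "polyfun (\<lambda>\<beta>. fps_nth (binomial_series m \<beta>) N)"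
  unfolding binomial_series_nth gbinomial_prod_rev
  by (intro polyfun_sum polyfun_mult polyfun_divide_const polyfun_prod polyfun_diff polyfun_id polyfun_const)

text \<open>Only the content product depends on \<open>\<beta>\<close>.\<close>

lemma polyfun_hook_term: "polyfun (\<lambda>\<beta>. fps_nth (hook_term \<beta> l) N)"
proof -
  have "fps_nth (hook_term \<beta> l) N = (\<Prod>v\<in>boxes l. of_int (content v) - \<beta>) /
      (\<Prod>v\<in>boxes l. of_nat (hook_length l v)) * fps_nth (fps_X ^ (sum_list l + b_stat l) *
      inverse (\<Prod>v\<in>boxes l. 1 - fps_X ^ hook_length l v)) N" for \<beta>
    by (simp only: hook_term_altdef mult.commute[of "fps_X ^ _" "fps_const _"] mult.assoc
          fps_mult_left_const_nth)
  then show ?thesis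
    by (auto intro!: polyfun_mult polyfun_divide_const polyfun_prod polyfun_diff polyfun_id polyfun_const)
qed

lemma prod_binomial_series_nth:
  "fps_nth (\<Prod>m\<le>N. binomial_series (Suc m) \<beta>) N =
    (\<Sum>l\<in>small_partitions N. fps_nth (hook_term \<beta> l) N)"
proof (rule polyfun_eqI[where x = \<beta>])
  fix n
  \<comment> \<open>Large enough both for the product to have stabilised at \<open>N\<close> and for
    the hook sum formula with \<open>m = Suc k\<close>.\<close>
  define k where "k = N + (\<Sum>i<n. Suc i * (n - 1 - i)) + n"
  have "fps_nth (\<Prod>m\<le>N. binomial_series (Suc m) (- of_nat n)) N =
      fps_nth (inverse (qpoch (Suc k)) ^ n) N"
    using prod_binomial_series_stable[of N k "- of_nat n"]
    by (simp add: k_def prod_binomial_series_neg)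
  also have "\<dots> = (\<Sum>l\<in>small_partitions N. fps_nth (hook_term (- of_nat n) l) N)"
    by (rule sum_hook_term_nth_neg[symmetric]) (simp add: k_def)
  finally show "fps_nth (\<Prod>m\<le>N. binomial_series (Suc m) (- of_nat n)) N =
      (\<Sum>l\<in>small_partitions N. fps_nth (hook_term (- of_nat n) l) N)" .
qed (intro polyfun_prod_nth polyfun_binomial_series polyfun_sum polyfun_hook_term)+

section \<open>Coefficientwise convergence of the sum and the product\<close>

lemma has_sum_hook_term:
  "(hook_term \<beta> has_sum Abs_fps (\<lambda>N. \<Sum>l\<in>small_partitions N. fps_nth (hook_term \<beta> l) N)) partitions"
  unfolding has_sum_def
proof (rule tendsto_fpsI)
  fix N
  show "\<forall>\<^sub>F Y in finite_subsets_at_top partitions. fps_nth (sum (hook_term \<beta>) Y) N =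
      fps_nth (Abs_fps (\<lambda>N. \<Sum>l\<in>small_partitions N. fps_nth (hook_term \<beta> l) N)) N"
    unfolding eventually_finite_subsets_at_top
  proof (intro exI[of _ "small_partitions N"] conjI allI impI finite_small_partitions)
    show "small_partitions N \<subseteq> partitions" by (auto simp: small_partitions_def)
    \<comment> \<open>Any further partition in \<open>Y\<close> has size above \<open>N\<close> and
      contributes nothing to this coefficient.\<close>
    fix Y assume Y: "finite Y \<and> small_partitions N \<subseteq> Y \<and> Y \<subseteq> partitions"
    then have "(\<Sum>l\<in>Y. fps_nth (hook_term \<beta> l) N) = (\<Sum>l\<in>small_partitions N. fps_nth (hook_term \<beta> l) N)"
      by (intro sum.mono_neutral_right)
         (auto simp: small_partitions_def not_le intro!: hook_term_nth_eq_0)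
    then show "fps_nth (sum (hook_term \<beta>) Y) N =
        fps_nth (Abs_fps (\<lambda>N. \<Sum>l\<in>small_partitions N. fps_nth (hook_term \<beta> l) N)) N"
      by (simp add: fps_sum_nth)
  qed
qed

lemma raw_has_prod_binomial_series:
  "raw_has_prod (\<lambda>m. binomial_series (Suc m) \<beta>) 0
    (Abs_fps (\<lambda>N. fps_nth (\<Prod>m\<le>N. binomial_series (Suc m) \<beta>) N))" (is "raw_has_prod _ _ ?L")
proof -
  have "(\<lambda>k. \<Prod>m\<le>k. binomial_series (Suc m) \<beta>) \<longlonglongrightarrow> ?L"
  proof (rule tendsto_fpsI)
    fix N
    show "\<forall>\<^sub>F k in sequentially. fps_nth (\<Prod>m\<le>k. binomial_series (Suc m) \<beta>) N = fps_nth ?L N"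
      using eventually_ge_at_top[of N]
      by eventually_elim (unfold fps_nth_Abs_fps, rule prod_binomial_series_stable)
  qed
  \<comment> \<open>\<open>raw_has_prod\<close> demands a nonzero limit, which the constant
    coefficient provides.\<close>
  moreover have "fps_nth ?L 0 = 1"
    using binomial_series_cong[of 1 \<beta>] by (simp add: fps_cong_def)
  then have "?L \<noteq> 0" by (metis fps_zero_nth zero_neq_one)
  ultimately show ?thesis by (simp add: raw_has_prod_def)
qed

theorem theorem8p3:
  fixes \<beta> :: complex
  shows "convergent_prod (\<lambda>m. binomial_series (Suc m) \<beta>) \<and>
         hook_term \<beta> summable_on partitions \<and>
         (\<Prod>m. binomial_series (Suc m) \<beta>) = (\<Sum>\<^sub>\<infinity>l\<in>partitions. hook_term \<beta> l)"
proof (intro conjI)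
  show "convergent_prod (\<lambda>m. binomial_series (Suc m) \<beta>)"
    using raw_has_prod_binomial_series unfolding convergent_prod_def by blast
  show "hook_term \<beta> summable_on partitions"
    using has_sum_hook_term by (rule has_sum_imp_summable)
  have "(\<Prod>m. binomial_series (Suc m) \<beta>) =
      Abs_fps (\<lambda>N. fps_nth (\<Prod>m\<le>N. binomial_series (Suc m) \<beta>) N)"
    by (rule has_prod_unique[symmetric]) (simp add: has_prod_def raw_has_prod_binomial_series)
  also have "\<dots> = Abs_fps (\<lambda>N. \<Sum>l\<in>small_partitions N. fps_nth (hook_term \<beta> l) N)"
    by (simp only: prod_binomial_series_nth)
  also have "\<dots> = (\<Sum>\<^sub>\<infinity>l\<in>partitions. hook_term \<beta> l)"
    using has_sum_hook_term by (rule infsumI[symmetric])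
  finally show "(\<Prod>m. binomial_series (Suc m) \<beta>) = (\<Sum>\<^sub>\<infinity>l\<in>partitions. hook_term \<beta> l)" .
qed

end
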